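(* Let $n\ge2$. Let $H\in C^0(\mathbb R^n)$ be convex and superlinear, with $H(0)=\min_{\mathbb R^n}H=0$, and suppose that $H$ is constant on a line segment $[a,b]\subset\mathbb R^n$ with $a\ne b$. Let $$u_f(x)=\frac{b+a}2\cdot x+\Big|\frac{b-a}2\cdot x\Big|,\qquad x\in\mathbb R^n.$$ Then $u_f$ is not in $C^1(\mathbb R^n)$ and does not have the linear approximation property in $\mathbb R^n$. Moreover $u_f$ does not satisfy the Liouville property: $u_f\in AM_H(\mathbb R^n)$ and $u_f$ has linear growth at infinity, but $u_f$ is not a linear function.
   Context: Superlinear means $\lim_{|p|\to\infty}H(p)/|p|=\infty$. A function $u\in W^{1,\infty}_{\rm loc}(\mathbb R^n)$ is an absolute minimizer for $H$ in $\mathbb R^n$, written $u\in AM_H(\mathbb R^n)$, if $\operatorname{ess\,sup}_{V}H(Du)\le \operatorname{ess\,sup}_{V}H(Dv)$ for every bounded open $V\subset\mathbb R^n$ and every $v\in W^{1,\infty}_{\rm loc}(V)\cap C(\overline V)$ with $v=u$ on $\partial V$. A function $u\in C^0(\mathbb R^n)$ has the linear approximation property if for every $x\in\mathbb R^n$ and every sequence of positive numbers $r_i\to0$ there exist a subsequence $(r_{i_k})$ and a vector $e\in\mathbb R^n$ such that $$\lim_{k\to\infty}\sup_{y\in B(0,1)}\Big|\frac{u(x+r_{i_k}y)-u(x)}{r_{i_k}}-e\cdot y\Big|=0.$$ $u$ has linear growth at infinity if there is $C>0$ with $|u(x)|\le C(1+|x|)$ for all $x$. "Linear function" means a function of the form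 $x\mapsto c+p\cdot x$. The Liouville property is the assertion that an absolute minimizer for $H$ on $\mathbb R^n$ with linear growth at infinity is a linear function. *)

theory Defs
  imports "HOL-Analysis.Analysis" "HOL-Probability.Essential_Supremum"
begin

definition partial_deriv :: "'n::finite \<Rightarrow> (real^'n \<Rightarrow> real) \<Rightarrow> real^'n \<Rightarrow> real" where
  "partial_deriv i f x = frechet_derivative f (at x) (axis i 1)"

primrec Ck :: "nat \<Rightarrow> (real^'n::finite \<Rightarrow> real) \<Rightarrow> bool" where
  "Ck 0 f \<longleftrightarrow> continuous_on UNIV f"
| "Ck (Suc k) f \<longleftrightarrow> (\<forall>x. f differentiable (at x)) \<and> (\<forall>i. Ck k (partial_deriv i f))"

definition test_function :: "(real^'n::finite) set \<Rightarrow> (real^'n \<Rightarrow> real) \<Rightarrow> bool" where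
  "test_function V \<phi> \<longleftrightarrow> (\<forall>k. Ck k \<phi>) \<and> compact (closure {x. \<phi> x \<noteq> 0}) \<and> closure {x. \<phi> x \<noteq> 0} \<subseteq> V"

definition Linf_loc :: "(real^'n::finite) set \<Rightarrow> (real^'n \<Rightarrow> 'b::{real_normed_vector, second_countable_topology}) \<Rightarrow> bool" where
  "Linf_loc V f \<longleftrightarrow> f \<in> borel_measurable (lebesgue_on V) \<and>
     (\<forall>K. compact K \<and> K \<subseteq> V \<longrightarrow> (\<exists>C. AE x in lebesgue_on K. norm (f x) \<le> C))"

text \<open>\<open>W1inf_loc V u Du\<close>: the function \<open>u\<close> lies in the local Sobolev space of exponent infinity
  on the open set \<open>V\<close>, and \<open>Du\<close> is a representative of its weak gradient there. Local boundedness
  makes all the integrals below converge.\<close>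

definition W1inf_loc :: "(real^'n::finite) set \<Rightarrow> (real^'n \<Rightarrow> real) \<Rightarrow> (real^'n \<Rightarrow> real^'n) \<Rightarrow> bool" where
  "W1inf_loc V u Du \<longleftrightarrow> Linf_loc V u \<and> Linf_loc V Du \<and>
     (\<forall>\<phi> i. test_function V \<phi> \<longrightarrow>
        (LINT x|lebesgue_on V. u x * partial_deriv i \<phi> x) = - (LINT x|lebesgue_on V. (Du x $ i) * \<phi> x))"

text \<open>Functions are not identified almost everywhere, so continuity selects the representative of
  \<open>u\<close> for which the boundary condition is meaningful. Weak gradients are unique up to null sets,
  hence the essential suprema do not depend on the representatives \<open>Du\<close> and \<open>Dv\<close>.\<close>

definition absolute_minimizer :: "(real^'n::finite \<Rightarrow> real) \<Rightarrow> (real^'n \<Rightarrow> real) \<Rightarrow> bool" where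
  "absolute_minimizer H u \<longleftrightarrow> continuous_on UNIV u \<and>
     (\<exists>Du. W1inf_loc UNIV u Du \<and>
       (\<forall>V v Dv. open V \<and> bounded V \<and> W1inf_loc V v Dv \<and> continuous_on (closure V) v \<and>
            (\<forall>x\<in>frontier V. v x = u x) \<longrightarrow>
          esssup (lebesgue_on V) (\<lambda>x. ereal (H (Du x))) \<le> esssup (lebesgue_on V) (\<lambda>x. ereal (H (Dv x)))))"

definition superlinear :: "(real^'n::finite \<Rightarrow> real) \<Rightarrow> bool" where
  "superlinear H \<longleftrightarrow> filterlim (\<lambda>p. H p / norm p) at_top at_infinity"

text \<open>The supremum is taken in the extended reals, where it is meaningful without any boundedness
  assumption.\<close>

definition linear_approximation_property :: "(real^'n::finite \<Rightarrow> real) \<Rightarrow> bool" where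
  "linear_approximation_property u \<longleftrightarrow>
     (\<forall>x (r :: nat \<Rightarrow> real). (\<forall>i. r i > 0) \<and> r \<longlonglongrightarrow> 0 \<longrightarrow>
       (\<exists>(s :: nat \<Rightarrow> nat) e. strict_mono s \<and>
         (\<lambda>k. SUP y\<in>ball 0 1. ereal \<bar>(u (x + r (s k) *\<^sub>R y) - u x) / r (s k) - e \<bullet> y\<bar>) \<longlonglongrightarrow> 0))"

definition linear_growth :: "(real^'n::finite \<Rightarrow> real) \<Rightarrow> bool" where
  "linear_growth u \<longleftrightarrow> (\<exists>C>0. \<forall>x. \<bar>u x\<bar> \<le> C * (1 + norm x))"

definition linear_function :: "(real^'n::finite \<Rightarrow> real) \<Rightarrow> bool" where
  "linear_function u \<longleftrightarrow> (\<exists>c p. \<forall>x. u x = c + p \<bullet> x)"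

definition u_f :: "real^'n::finite \<Rightarrow> real^'n \<Rightarrow> real^'n \<Rightarrow> real" where
  "u_f a b x = ((b + a) /\<^sub>R 2) \<bullet> x + \<bar>((b - a) /\<^sub>R 2) \<bullet> x\<bar>"

end

theory Submission imports Defs begin

text \<open>The function \<open>u_f\<close> is the maximum of the two linear functions \<open>a \<bullet> x\<close> and \<open>b \<bullet> x\<close>. It is positively
  homogeneous but \<open>u_f(y) + u_f(-y) = |(b - a) \<bullet> y|\<close> does not vanish identically, so the origin alone
  refutes differentiability, linear approximation and linearity.

  The substance is that \<open>u_f\<close> is an absolute minimizer. Its gradient takes the values \<open>a\<close> and \<open>b\<close>, so
  \<open>H(Du_f)\<close> equals the constant \<open>c\<close> that \<open>H\<close> takes on \<open>[a,b]\<close>, and it has to be shown that no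
  competitor on a bounded open set \<open>V\<close> does better than \<open>c\<close>. If \<open>H(Dv) \<le> l < c\<close> almost everywhere in \<open>V\<close>,
  then \<open>Dv\<close> lies in the closed convex set \<open>{H \<le> l}\<close>, which is disjoint from the compact segment \<open>[a,b]\<close>.
  A strictly separating hyperplane gives \<open>e\<close> and \<open>t\<close> with \<open>e \<bullet> Dv < t\<close> almost everywhere, while
  \<open>e \<bullet> a > t\<close> and \<open>e \<bullet> b > t\<close>. On a chord of \<open>V\<close> in direction \<open>e\<close> of parameter length \<open>s\<close>, the function
  \<open>v\<close> increases by at most \<open>t * s\<close> (lemma \<open>weak_directional_bound_chord\<close>) and \<open>u_f\<close> by more than \<open>t * s\<close>
  (lemma \<open>u_f_increase\<close>). The end points of the chord are boundary points of \<open>V\<close>, where the two functions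
  agree: a contradiction.

  The analytic work is the passage between weak gradients and pointwise behaviour, in both
  directions: the almost everywhere gradient of a Lipschitz function is its weak gradient
  (lemma \<open>W1inf_loc_lipschitz\<close>), and an almost everywhere bound on a weak directional derivative
  of a continuous function holds on every segment (lemma \<open>weak_directional_bound\<close>). Both
  rest on differentiating \<open>\<integral> w(y) \<phi>(y - \<tau>e) dy\<close> in \<open>\<tau>\<close>, and the second one on smooth
  bump functions.\<close>

section \<open>Smooth bump functions\<close>

text \<open>The factor \<open>1 / t ^ m\<close> is there because it makes the family closed under
  differentiation, up to linear combinations; the bumps only use \<open>m = 0\<close>.\<close>

definition flat :: "nat \<Rightarrow> real \<Rightarrow> real" where
  "flat m t = (if t > 0 then exp (- (1 / t)) / t ^ m else 0)"

lemma flat_nonneg: "0 \<le> flat m t"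
  by (simp add: flat_def)

lemma flat_tendsto_0: "(flat m \<longlongrightarrow> 0) (at_right 0)"
proof -
  have "((\<lambda>x. x ^ m / exp x) \<longlongrightarrow> (0::real)) at_top"
    by (rule tendsto_power_div_exp_0)
  moreover have "\<forall>\<^sub>F x in at_top. x ^ m / exp x = flat m (inverse x)"
    using eventually_gt_at_top[of 0]
    by eventually_elim (simp add: flat_def exp_minus field_simps)
  ultimately show ?thesis
    unfolding filterlim_at_right_to_top by (rule Lim_transform_eventually)
qed

text \<open>The only delicate point is \<open>t = 0\<close>, where the difference quotient of \<open>flat m\<close> from the right
  is \<open>flat (m + 1)\<close> and so tends to \<open>0\<close>.\<close>

lemma flat_has_derivative:
  "(flat m has_real_derivative (flat (m + 2) t - m * flat (m + 1) t)) (at t)"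
proof -
  consider "t > 0" | "t < 0" | "t = 0" by linarith
  then show ?thesis
  proof cases
    case 1
    have "((\<lambda>t. exp (- (1 / t))) has_real_derivative exp (- (1 / t)) * (1 / t\<^sup>2)) (at t)"
      using 1 by (auto intro!: derivative_eq_intros simp: power2_eq_square)
    moreover have "((\<lambda>t. inverse t ^ m) has_real_derivative
                     m * inverse t ^ (m - 1) * (- (1 / t\<^sup>2))) (at t)"
      using DERIV_power[OF DERIV_inverse[of t UNIV], of m] 1
      by (simp add: power2_eq_square divide_inverse mult_ac)
    ultimately have "((\<lambda>t. exp (- (1 / t)) * inverse t ^ m) has_real_derivative
            exp (- (1 / t)) * (1 / t\<^sup>2) * inverse t ^ m
            + (m * inverse t ^ (m - 1) * (- (1 / t\<^sup>2))) * exp (- (1 / t))) (at t)"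
      by (rule DERIV_mult)
    moreover have "exp (- (1 / t)) * (1 / t\<^sup>2) * inverse t ^ m
            + (m * inverse t ^ (m - 1) * (- (1 / t\<^sup>2))) * exp (- (1 / t))
            = flat (m + 2) t - m * flat (m + 1) t"
      using 1 by (cases m) (simp_all add: flat_def power2_eq_square power_inverse divide_inverse)
    ultimately have "((\<lambda>t. exp (- (1 / t)) * inverse t ^ m) has_real_derivative
            flat (m + 2) t - m * flat (m + 1) t) (at t)"
      by simp
    then show ?thesis
      by (rule has_field_derivative_transform_within_open[where S="{0<..}"])
         (use 1 in \<open>auto simp: flat_def divide_inverse power_inverse\<close>)
  next
    case 2
    have "((\<lambda>t. 0) has_real_derivative (flat (m + 2) t - m * flat (m + 1) t)) (at t)"
      using 2 by (auto simp: flat_def)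
    then show ?thesis
      by (rule has_field_derivative_transform_within_open[where S="{..<0}"])
         (use 2 in \<open>auto simp: flat_def\<close>)
  next
    case 3
    have l: "((\<lambda>y. (flat m y - flat m 0) / (y - 0)) \<longlongrightarrow> 0) (at_left 0)"
      by (rule tendsto_eventually) (auto simp: flat_def eventually_at_filter)
    have r: "((\<lambda>y. (flat m y - flat m 0) / (y - 0)) \<longlongrightarrow> 0) (at_right 0)"
      using flat_tendsto_0[of "m + 1"]
      by (rule Lim_transform_eventually) (auto simp: flat_def eventually_at_filter)
    show ?thesis
      using filterlim_split_at_real[OF l r] 3
      by (simp add: has_field_derivative_iff flat_def)
  qed
qed

lemma flat_comp_has_derivative [derivative_intros]:
  assumes "(q has_derivative q') (at x)"
  shows "((\<lambda>x. flat m (q x)) has_derivative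
           (\<lambda>h. (flat (m + 2) (q x) - m * flat (m + 1) (q x)) * q' h)) (at x)"
  using has_derivative_compose[OF assms, of "flat m" ] flat_has_derivative[of m "q x"]
  by (simp add: has_field_derivative_def)

lemma Ck_0_differentiable: "(\<And>x. f differentiable (at x)) \<Longrightarrow> Ck 0 f"
  by (auto intro!: differentiable_imp_continuous_within simp: continuous_on_eq_continuous_within)

text \<open>Infinite differentiability is proved without computing any higher derivative: this ring contains
  the bumps and is closed under partial derivatives, so each of its members is \<open>C\<^sup>k\<close> for every
  \<open>k\<close>.\<close>

inductive_set flat_ring :: "((real^'n::finite) \<Rightarrow> real) set" where
  const: "(\<lambda>x. k) \<in> flat_ring"
| coord: "(\<lambda>x. x $ i) \<in> flat_ring"
| flat: "(\<lambda>x. flat m (r\<^sup>2 - (x - c) \<bullet> (x - c))) \<in> flat_ring"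
| add: "f \<in> flat_ring \<Longrightarrow> g \<in> flat_ring \<Longrightarrow> (\<lambda>x. f x + g x) \<in> flat_ring"
| mult: "f \<in> flat_ring \<Longrightarrow> g \<in> flat_ring \<Longrightarrow> (\<lambda>x. f x * g x) \<in> flat_ring"

lemma flat_ring_derivative:
  fixes f :: "real^'n::finite \<Rightarrow> real"
  shows "f \<in> flat_ring \<Longrightarrow>
     \<exists>D. (\<forall>x. (f has_derivative D x) (at x)) \<and> (\<forall>i. (\<lambda>x. D x (axis i 1)) \<in> flat_ring)"
proof (induction rule: flat_ring.induct)
  case (const k)
  show ?case
    by (rule exI[of _ "\<lambda>x h. 0"]) (auto intro: flat_ring.const)
next
  case (coord j)
  have "((\<lambda>x. x $ j) has_derivative (\<lambda>h. h $ j)) (at x)" for x :: "real^'n"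
    by (rule bounded_linear_imp_has_derivative) (rule bounded_linear_vec_nth)
  then show ?case
    by (intro exI[of _ "\<lambda>x h. h $ j"]) (auto intro: flat_ring.const)
next
  case (flat m r c)
  let ?q = "\<lambda>x. r\<^sup>2 - (x - c) \<bullet> (x - c)"
  let ?D = "\<lambda>x h. (flat (m + 2) (?q x) + (- real m) * flat (m + 1) (?q x)) * ((- 2) * ((x - c) \<bullet> h))"
  have "((\<lambda>x. flat m (?q x)) has_derivative ?D x) (at x)" for x
    by (auto intro!: derivative_eq_intros simp: inner_commute algebra_simps)
  moreover have "(\<lambda>x. ?D x (axis i 1)) \<in> flat_ring" for i
  proof -
    have "(\<lambda>x. (flat (m + 2) (?q x) + (- real m) * flat (m + 1) (?q x)) * ((- 2) * (x $ i + (- (c $ i)))))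
            \<in> flat_ring"
      by (intro flat_ring.intros)
    then show ?thesis
      by (simp add: inner_axis)
  qed
  ultimately show ?case
    by (intro exI[of _ ?D]) blast
next
  case (add f g)
  then obtain D E where DE: "\<And>x. (f has_derivative D x) (at x)" "\<And>i. (\<lambda>x. D x (axis i 1)) \<in> flat_ring"
    "\<And>x. (g has_derivative E x) (at x)" "\<And>i. (\<lambda>x. E x (axis i 1)) \<in> flat_ring"
    by blast
  show ?case
    by (rule exI[of _ "\<lambda>x h. D x h + E x h"])
       (auto intro!: has_derivative_add DE flat_ring.add)
next
  case (mult f g)
  then obtain D E where DE: "\<And>x. (f has_derivative D x) (at x)" "\<And>i. (\<lambda>x. D x (axis i 1)) \<in> flat_ring"
    "\<And>x. (g has_derivative E x) (at x)" "\<And>i. (\<lambda>x. E x (axis i 1)) \<in> flat_ring"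
    by blast
  show ?case
    by (rule exI[of _ "\<lambda>x h. f x * E x h + D x h * g x"])
       (auto intro!: has_derivative_mult DE flat_ring.add flat_ring.mult mult.hyps)
qed

lemma flat_ring_Ck: "f \<in> flat_ring \<Longrightarrow> Ck k f"
proof (induction k arbitrary: f)
  case 0
  then show ?case
    using flat_ring_derivative Ck_0_differentiable differentiableI by blast
next
  case (Suc k)
  obtain D where D: "\<And>x. (f has_derivative D x) (at x)" "\<And>i. (\<lambda>x. D x (axis i 1)) \<in> flat_ring"
    using flat_ring_derivative[OF Suc.prems] by blast
  have "partial_deriv i f = (\<lambda>x. D x (axis i 1))" for i
    using frechet_derivative_at[OF D(1)] by (auto simp: partial_deriv_def fun_eq_iff)
  with D Suc.IH show ?case
    by (auto intro: differentiableI)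
qed

definition bump :: "real \<Rightarrow> real^'n::finite \<Rightarrow> real^'n \<Rightarrow> real" where
  "bump r c x = flat 0 (r\<^sup>2 - (x - c) \<bullet> (x - c))"

lemma bump_nonneg: "0 \<le> bump r c x"
  by (simp add: bump_def flat_nonneg)

lemma bump_pos_iff: "r > 0 \<Longrightarrow> bump r c x > 0 \<longleftrightarrow> x \<in> ball c r"
  by (simp add: bump_def flat_def dist_norm norm_minus_commute[of c] norm_lt_square)

lemma bump_translate: "bump r (c + d) x = bump r c (x - d)"
  by (simp add: bump_def algebra_simps)

lemma test_function_bump:
  assumes "r > 0" "cball c r \<subseteq> V"
  shows "test_function V (bump r c)"
proof -
  have "{x. bump r c x \<noteq> 0} = ball c r"
    using bump_pos_iff[OF \<open>r > 0\<close>, of c] bump_nonneg[of r c]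
    by (auto simp: order_less_le simp del: mem_ball)
  moreover have "bump r c \<in> flat_ring"
    unfolding bump_def[abs_def] by (rule flat_ring.flat)
  ultimately show ?thesis
    using assms by (simp add: test_function_def flat_ring_Ck)
qed

section \<open>Translates of a test function\<close>

lemma integral_compact_support:
  fixes f :: "'a::euclidean_space \<Rightarrow> real"
  assumes "continuous_on UNIV f" "\<And>x. x \<notin> cbox a b \<Longrightarrow> f x = 0"
  shows "integrable lborel f" "(LINT x|lborel. f x) = integral (cbox a b) f"
proof -
  have "(\<lambda>x. indicator (cbox a b) x *\<^sub>R f x) = f"
    using assms(2) by (auto simp: fun_eq_iff indicator_def)
  with borel_integrable_compact[of "cbox a b" f] show i: "integrable lborel f"
    using assms(1) by (auto intro: continuous_on_subset)
  have "(\<lambda>x. if x \<in> cbox a b then f x else 0) = f"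
    using assms(2) by auto
  then show "(LINT x|lborel. f x) = integral (cbox a b) f"
    using integral_lborel[OF i] integral_restrict_UNIV[of "cbox a b" f] by simp
qed

lemma integrable_compact_support:
  fixes f :: "'a::euclidean_space \<Rightarrow> real"
  assumes "continuous_on UNIV f" "compact K" "\<And>x. x \<notin> K \<Longrightarrow> f x = 0"
  shows "integrable lborel f"
proof -
  obtain a where "K \<subseteq> cbox (-a) a"
    using bounded_subset_cbox_symmetric compact_imp_bounded[OF assms(2)] by blast
  then show ?thesis
    using assms by (intro integral_compact_support(1)[of f "-a" a]) auto
qed

lemma derivative_zero_off_support:
  fixes \<phi> :: "'a::real_normed_vector \<Rightarrow> real"
  assumes "(\<phi> has_derivative D) (at x)" "closed K" "\<And>x. x \<notin> K \<Longrightarrow> \<phi> x = 0" "x \<notin> K"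
  shows "D e = 0"
proof -
  have "(\<phi> has_derivative (\<lambda>_. 0)) (at x)"
    using assms(2-4)
    by (intro has_derivative_transform_within_open[OF has_derivative_const, of "-K"]) auto
  then show ?thesis
    using assms(1) has_derivative_unique by metis
qed

text \<open>Differentiation under the integral sign. This is used twice: at \<open>\<tau>\<^sub>0 = 0\<close> it identifies the weak
  gradient of a Lipschitz function, and along a whole segment it shows how the mollification of a
  function with a one-sided bound on a weak directional derivative can grow.\<close>

lemma translation_derivative:
  fixes w \<phi> :: "'a::euclidean_space \<Rightarrow> real"
  assumes w: "continuous_on UNIV w"
    and \<phi>: "\<And>x. (\<phi> has_derivative D x) (at x)"
    and cont: "continuous_on UNIV (\<lambda>x. D x e)"
    and K: "compact K" "\<And>x. x \<notin> K \<Longrightarrow> \<phi> x = 0"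
  shows "((\<lambda>\<tau>. LINT y|lborel. w y * \<phi> (y - \<tau> *\<^sub>R e)) has_real_derivative
           - (LINT y|lborel. w y * D (y - \<tau>\<^sub>0 *\<^sub>R e) e)) (at \<tau>\<^sub>0)"
proof -
  \<comment> \<open>For bounded \<open>\<tau>\<close> all translates of \<open>\<phi>\<close> live in one fixed box, where the Leibniz rule
    applies.\<close>
  define T where "T = \<bar>\<tau>\<^sub>0\<bar> + 1"
  define U where "U = {-T<..<T}"
  have U: "\<tau>\<^sub>0 \<in> U" "convex U" "open U"
    by (auto simp: U_def T_def)
  obtain R where R: "\<And>x. x \<in> K \<Longrightarrow> norm x \<le> R"
    using compact_imp_bounded[OF K(1)] bounded_iff by metis
  obtain a where a: "cball 0 (R + T * norm e) \<subseteq> cbox (-a) (a::'a)"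
    using bounded_subset_cbox_symmetric bounded_cball by blast
  have out: "y - \<tau> *\<^sub>R e \<notin> K" if "\<tau> \<in> U" "y \<notin> cbox (-a) a" for \<tau> y
  proof
    assume "y - \<tau> *\<^sub>R e \<in> K"
    then have "norm y \<le> R + \<bar>\<tau>\<bar> * norm e"
      using R norm_triangle_sub[of y "\<tau> *\<^sub>R e"] by fastforce
    moreover have "\<bar>\<tau>\<bar> * norm e \<le> T * norm e"
      using that(1) by (intro mult_right_mono) (auto simp: U_def)
    ultimately show False
      using a that(2) by (auto simp: subset_iff)
  qed
  have \<phi>c: "continuous_on UNIV \<phi>"
    using \<phi> by (meson has_derivative_continuous continuous_at_imp_continuous_on)
  have f: "continuous_on UNIV (\<lambda>y. w y * \<phi> (y - \<tau> *\<^sub>R e))" for \<tau>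
    by (intro continuous_intros w continuous_on_compose2[OF \<phi>c]) auto
  have f': "continuous_on UNIV (\<lambda>y. w y * D (y - \<tau> *\<^sub>R e) e)" for \<tau>
    by (intro continuous_intros w continuous_on_compose2[OF cont]) auto
  have "((\<lambda>\<tau>. integral (cbox (-a) a) (\<lambda>y. w y * \<phi> (y - \<tau> *\<^sub>R e))) has_real_derivative
          integral (cbox (-a) a) (\<lambda>y. - (w y * D (y - \<tau>\<^sub>0 *\<^sub>R e) e))) (at \<tau>\<^sub>0 within U)"
  proof (rule leibniz_rule_field_derivative)
    fix \<tau> y
    have "((\<lambda>\<tau>. \<phi> (y - \<tau> *\<^sub>R e)) has_derivative (\<lambda>h. D (y - \<tau> *\<^sub>R e) (- (h *\<^sub>R e)))) (at \<tau>)"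
      by (rule has_derivative_compose[OF _ \<phi>]) (auto intro!: derivative_eq_intros)
    moreover have "linear (D (y - \<tau> *\<^sub>R e))"
      using \<phi> has_derivative_linear by blast
    moreover have "(\<lambda>h. D (y - \<tau> *\<^sub>R e) (- (h *\<^sub>R e))) = (*) (- D (y - \<tau> *\<^sub>R e) e)"
      using calculation(2) by (auto simp: fun_eq_iff linear_neg linear_scale)
    ultimately have "((\<lambda>\<tau>. \<phi> (y - \<tau> *\<^sub>R e)) has_real_derivative - D (y - \<tau> *\<^sub>R e) e) (at \<tau>)"
      by (simp add: has_field_derivative_def)
    then have "((\<lambda>\<tau>. w y * \<phi> (y - \<tau> *\<^sub>R e)) has_real_derivative w y * - D (y - \<tau> *\<^sub>R e) e) (at \<tau>)"
      by (rule DERIV_cmult)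
    then show "((\<lambda>\<tau>. w y * \<phi> (y - \<tau> *\<^sub>R e)) has_real_derivative - (w y * D (y - \<tau> *\<^sub>R e) e)) (at \<tau> within U)"
      by (auto intro: has_field_derivative_at_within)
  next
    show "(\<lambda>y. w y * \<phi> (y - \<tau> *\<^sub>R e)) integrable_on cbox (-a) a" for \<tau>
      using f continuous_on_subset by (blast intro: integrable_continuous)
    show "continuous_on (U \<times> cbox (-a) a) (\<lambda>(\<tau>, y). - (w y * D (y - \<tau> *\<^sub>R e) e))"
      unfolding split_def
      by (intro continuous_intros continuous_on_compose2[OF w] continuous_on_compose2[OF cont]) auto
  qed (use U in auto)
  then have "((\<lambda>\<tau>. integral (cbox (-a) a) (\<lambda>y. w y * \<phi> (y - \<tau> *\<^sub>R e))) has_real_derivative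
          - integral (cbox (-a) a) (\<lambda>y. w y * D (y - \<tau>\<^sub>0 *\<^sub>R e) e)) (at \<tau>\<^sub>0)"
    by (simp add: at_within_open[OF U(1) U(3)])
  moreover have "integral (cbox (-a) a) (\<lambda>y. w y * \<phi> (y - \<tau> *\<^sub>R e)) = (LINT y|lborel. w y * \<phi> (y - \<tau> *\<^sub>R e))"
    if "\<tau> \<in> U" for \<tau>
    using K(2) out[OF that] by (intro integral_compact_support(2)[symmetric] f) auto
  moreover have "integral (cbox (-a) a) (\<lambda>y. w y * D (y - \<tau>\<^sub>0 *\<^sub>R e) e) = (LINT y|lborel. w y * D (y - \<tau>\<^sub>0 *\<^sub>R e) e)"
    using derivative_zero_off_support[OF \<phi> compact_imp_closed[OF K(1)] K(2)] out[OF U(1)]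
    by (intro integral_compact_support(2)[symmetric] f') auto
  ultimately show ?thesis
    using U has_field_derivative_transform_within_open[of _ _ \<tau>\<^sub>0 U] by simp
qed

lemma integral_translation:
  fixes f :: "'a::euclidean_space \<Rightarrow> real"
  assumes "f \<in> borel_measurable borel"
  shows "(LINT y|lborel. f (y + d)) = (LINT y|lborel. f y)"
proof -
  have "(LINT y|lborel. f y) = (LINT y|distr lborel borel ((+) d). f y)"
    by (simp add: lborel_distr_plus)
  also have "\<dots> = (LINT y|lborel. f (d + y))"
    using assms by (intro integral_distr) auto
  finally show ?thesis
    by (simp add: add.commute)
qed

section \<open>Weak gradients\<close>

text \<open>Translation invariance moves the difference quotient from \<open>\<phi>\<close> to \<open>u\<close>:
  \<open>\<integral> u(y) (\<phi>(y - \<tau>e) - \<phi>(y)) / \<tau> dy = \<integral> (u(y + \<tau>e) - u(y)) / \<tau> \<phi>(y) dy\<close>.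
  As \<open>\<tau>\<close> tends to \<open>0\<close> the left side converges by differentiation under the integral, and the right side
  by dominated convergence, since the quotients of \<open>u\<close> are bounded by its Lipschitz constant.\<close>

lemma lipschitz_weak_derivative:
  fixes u \<phi> :: "'a::euclidean_space \<Rightarrow> real"
  assumes L: "L-lipschitz_on UNIV u"
    and G: "AE x in lborel. (u has_derivative (\<lambda>h. G x \<bullet> h)) (at x)" "G \<in> borel_measurable borel"
    and \<phi>: "\<And>x. (\<phi> has_derivative D x) (at x)"
    and cont: "continuous_on UNIV (\<lambda>x. D x e)"
    and K: "compact K" "\<And>x. x \<notin> K \<Longrightarrow> \<phi> x = 0"
  shows "(LINT x|lborel. u x * D x e) = - (LINT x|lborel. (G x \<bullet> e) * \<phi> x)"
proof -
  define F where "F \<tau> = (LINT y|lborel. u y * \<phi> (y - \<tau> *\<^sub>R e))" for \<tau>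
  define X where "X n = inverse (real (Suc n))" for n
  have X: "X \<longlonglongrightarrow> 0" "X n > 0" for n
    using LIMSEQ_inverse_real_of_nat by (auto simp: X_def[abs_def])
  have uc: "continuous_on UNIV u"
    using L lipschitz_on_continuous_on by blast
  have \<phi>c: "continuous_on UNIV \<phi>"
    using \<phi> by (meson has_derivative_continuous continuous_at_imp_continuous_on)
  have [measurable]: "u \<in> borel_measurable borel" "\<phi> \<in> borel_measurable borel" "G \<in> borel_measurable borel"
    using uc \<phi>c G borel_measurable_continuous_onI by blast+
  have int: "integrable lborel (\<lambda>y. u (y + d) * \<phi> y)" for d
    using K by (intro integrable_compact_support[of _ K] continuous_intros \<phi>c
      continuous_on_compose2[OF uc]) auto
  have F: "F \<tau> = (LINT y|lborel. u (y + \<tau> *\<^sub>R e) * \<phi> y)" for \<tau>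
    unfolding F_def using integral_translation[of "\<lambda>y. u y * \<phi> (y - \<tau> *\<^sub>R e)" "\<tau> *\<^sub>R e"] by simp
  have "(F has_real_derivative - (LINT y|lborel. u y * D y e)) (at 0)"
    using translation_derivative[OF uc \<phi> cont K, of 0] by (simp add: F_def[abs_def])
  then have "((\<lambda>h. (F h - F 0) / h) \<longlongrightarrow> - (LINT y|lborel. u y * D y e)) (at 0)"
    by (simp add: has_field_derivative_iff)
  then have 1: "(\<lambda>n. (F (X n) - F 0) / X n) \<longlonglongrightarrow> - (LINT y|lborel. u y * D y e)"
    by (rule filterlim_compose) (use X in \<open>auto simp: filterlim_at less_imp_neq[symmetric]\<close>)
  have Fq: "(F (X n) - F 0) / X n = (LINT y|lborel. (u (y + X n *\<^sub>R e) - u y) / X n * \<phi> y)" for n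
  proof -
    have "F (X n) - F 0 = (LINT y|lborel. (u (y + X n *\<^sub>R e) * \<phi> y - u y * \<phi> y))"
      using int[of 0] int[of "X n *\<^sub>R e"] by (simp add: F)
    also have "\<dots> / X n = (LINT y|lborel. (u (y + X n *\<^sub>R e) * \<phi> y - u y * \<phi> y) / X n)"
      by simp
    also have "\<dots> = (LINT y|lborel. (u (y + X n *\<^sub>R e) - u y) / X n * \<phi> y)"
      by (simp add: left_diff_distrib)
    finally show ?thesis .
  qed
  have "(\<lambda>n. LINT y|lborel. (u (y + X n *\<^sub>R e) - u y) / X n * \<phi> y) \<longlonglongrightarrow> (LINT y|lborel. (G y \<bullet> e) * \<phi> y)"
  proof (rule integral_dominated_convergence)
    show "integrable lborel (\<lambda>y. (L * norm e) * \<bar>\<phi> y\<bar>)"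
      using K by (intro integrable_compact_support[of _ K] continuous_intros \<phi>c) auto
    show "AE y in lborel. (\<lambda>n. (u (y + X n *\<^sub>R e) - u y) / X n * \<phi> y) \<longlonglongrightarrow> (G y \<bullet> e) * \<phi> y"
      using G(1)
    proof eventually_elim
      case (elim y)
      have "((\<lambda>t. u (y + t *\<^sub>R e)) has_derivative (\<lambda>t. G y \<bullet> (t *\<^sub>R e))) (at 0)"
        by (rule has_derivative_compose[of "\<lambda>t. y + t *\<^sub>R e" _ _ _ u]) 
           (use elim in \<open>auto intro!: derivative_eq_intros\<close>)
      then have "((\<lambda>t. u (y + t *\<^sub>R e)) has_real_derivative (G y \<bullet> e)) (at 0)"
        by (simp add: has_field_derivative_def mult_commute_abs)
      then have "((\<lambda>t. (u (y + t *\<^sub>R e) - u y) / t) \<longlongrightarrow> G y \<bullet> e) (at 0)"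
        by (simp add: has_field_derivative_iff)
      then have "(\<lambda>n. (u (y + X n *\<^sub>R e) - u y) / X n) \<longlonglongrightarrow> G y \<bullet> e"
        by (rule filterlim_compose) (use X in \<open>auto simp: filterlim_at less_imp_neq[symmetric]\<close>)
      then show ?case
        by (intro tendsto_intros)
    qed
    show "AE y in lborel. norm ((u (y + X n *\<^sub>R e) - u y) / X n * \<phi> y) \<le> (L * norm e) * \<bar>\<phi> y\<bar>" for n
    proof (intro AE_I2)
      fix y
      have "\<bar>u (y + X n *\<^sub>R e) - u y\<bar> \<le> L * (X n * norm e)"
        using lipschitz_onD[OF L, of "y + X n *\<^sub>R e" y] X(2)[of n] by (simp add: dist_norm)
      then have "\<bar>u (y + X n *\<^sub>R e) - u y\<bar> / X n \<le> L * norm e"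
        using X(2)[of n] by (simp add: field_simps)
      then show "norm ((u (y + X n *\<^sub>R e) - u y) / X n * \<phi> y) \<le> (L * norm e) * \<bar>\<phi> y\<bar>"
        using X(2)[of n] mult_right_mono[of _ _ "\<bar>\<phi> y\<bar>"] by (fastforce simp: abs_mult)
    qed
  qed measurable
  with 1 have "- (LINT y|lborel. u y * D y e) = (LINT y|lborel. (G y \<bullet> e) * \<phi> y)"
    unfolding Fq by (rule LIMSEQ_unique)
  then show ?thesis by simp
qed

lemma test_function_derivative:
  assumes "test_function V \<phi>"
  obtains D where "\<And>x. (\<phi> has_derivative D x) (at x)"
    and "\<And>x i. D x (axis i 1) = partial_deriv i \<phi> x"
    and "\<And>x e. D x e = (\<Sum>i\<in>UNIV. e $ i * partial_deriv i \<phi> x)"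
    and "\<And>i. continuous_on UNIV (partial_deriv i \<phi>)"
proof -
  have "Ck 1 \<phi>"
    using assms by (simp add: test_function_def)
  then have \<phi>: "\<And>x. \<phi> differentiable (at x)" "\<And>i. continuous_on UNIV (partial_deriv i \<phi>)"
    by auto
  have d: "(\<phi> has_derivative frechet_derivative \<phi> (at x)) (at x)" for x
    using \<phi>(1) frechet_derivative_works by blast
  have sum: "frechet_derivative \<phi> (at x) e = (\<Sum>i\<in>UNIV. e $ i * partial_deriv i \<phi> x)" for x e
  proof -
    have l: "linear (frechet_derivative \<phi> (at x))"
      using d has_derivative_linear by blast
    have "e = (\<Sum>i\<in>UNIV. e $ i *\<^sub>R axis i 1)"
      using basis_expansion[of e] by (simp add: scalar_mult_eq_scaleR)
    then have "frechet_derivative \<phi> (at x) e = frechet_derivative \<phi> (at x) (\<Sum>i\<in>UNIV. e $ i *\<^sub>R axis i 1)"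
      by metis
    also have "\<dots> = (\<Sum>i\<in>UNIV. e $ i * partial_deriv i \<phi> x)"
      by (simp add: linear_sum[OF l] linear_scale[OF l] partial_deriv_def)
    finally show ?thesis .
  qed
  show ?thesis
  proof (rule that)
    show "(\<phi> has_derivative frechet_derivative \<phi> (at x)) (at x)" for x
      by (rule d)
    show "frechet_derivative \<phi> (at x) (axis i 1) = partial_deriv i \<phi> x" for x i
      by (simp add: partial_deriv_def)
  qed (fact sum \<phi>(2))+
qed

lemma Linf_loc_times_compact_support:
  fixes f \<phi> :: "real^'n::finite \<Rightarrow> real"
  assumes f: "Linf_loc V f" and V: "open V"
    and \<phi>: "continuous_on UNIV \<phi>" and K: "compact K" "K \<subseteq> V" "\<And>x. x \<notin> K \<Longrightarrow> \<phi> x = 0"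
  shows "integrable (lebesgue_on V) (\<lambda>x. f x * \<phi> x)"
proof -
  have [measurable]: "f \<in> borel_measurable (lebesgue_on V)"
    using f by (simp add: Linf_loc_def)
  have Vs: "V \<in> sets lebesgue" and Ks: "K \<in> sets lebesgue"
    using V lmeasurable_compact[OF K(1)] by auto
  have [measurable]: "\<phi> \<in> borel_measurable (lebesgue_on V)"
    by (rule continuous_imp_measurable_on_sets_lebesgue[OF continuous_on_subset[OF \<phi>] Vs]) auto
  obtain C where C: "AE x in lebesgue_on K. norm (f x) \<le> C"
    using f K unfolding Linf_loc_def by blast
  have "integrable lborel \<phi>"
    using integrable_compact_support[OF \<phi> K(1,3)] .
  then have "integrable lebesgue \<phi>"
    using borel_measurable_continuous_onI[OF \<phi>] by (simp add: integrable_completion)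
  then have "integrable (lebesgue_on V) \<phi>"
    using Vs integrable_restrict_space[of V lebesgue \<phi>] integrable_mult_indicator[of V lebesgue \<phi>] by simp
  then have "integrable (lebesgue_on V) (\<lambda>x. C * \<phi> x)"
    by simp
  then show ?thesis
  proof (rule Bochner_Integration.integrable_bound)
    have "AE x in lebesgue. x \<in> K \<longrightarrow> norm (f x) \<le> C"
      using C Ks by (simp add: AE_restrict_space_iff)
    then have "AE x in lebesgue. x \<in> V \<longrightarrow> norm (f x * \<phi> x) \<le> norm (C * \<phi> x)"
    proof eventually_elim
      case (elim x)
      then show ?case
        using K(3)[of x] by (cases "x \<in> K") (auto simp: abs_mult intro!: mult_right_mono)
    qed
    then show "AE x in lebesgue_on V. norm (f x * \<phi> x) \<le> norm (C * \<phi> x)"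
      using Vs by (simp add: AE_restrict_space_iff)
  qed measurable
qed

lemma test_function_support:
  assumes "test_function V \<phi>"
  obtains K where "compact K" "K \<subseteq> V" "\<And>x. x \<notin> K \<Longrightarrow> \<phi> x = 0"
proof (rule that)
  have "compact (closure {x. \<phi> x \<noteq> 0}) \<and> closure {x. \<phi> x \<noteq> 0} \<subseteq> V"
    using assms by (simp add: test_function_def)
  then show "compact (closure {x. \<phi> x \<noteq> 0})" "closure {x. \<phi> x \<noteq> 0} \<subseteq> V"
    by simp_all
  fix x assume "x \<notin> closure {x. \<phi> x \<noteq> 0}"
  then have "x \<notin> {x. \<phi> x \<noteq> 0}"
    using closure_subset by (rule contra_subsetD[rotated])
  then show "\<phi> x = 0"
    by simp
qed

lemma W1inf_loc_lipschitz:
  fixes u :: "real^'n::finite \<Rightarrow> real"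
  assumes L: "L-lipschitz_on UNIV u"
    and G: "AE x in lborel. (u has_derivative (\<lambda>h. G x \<bullet> h)) (at x)" "G \<in> borel_measurable borel"
    and B: "\<And>x. norm (G x) \<le> B"
  shows "W1inf_loc UNIV u G"
proof -
  have uc: "continuous_on UNIV u"
    using L lipschitz_on_continuous_on by blast
  note [measurable] = borel_measurable_continuous_onI[OF uc] G(2)
  have "Linf_loc UNIV u"
    unfolding Linf_loc_def
  proof (intro conjI allI impI)
    show "u \<in> borel_measurable (lebesgue_on UNIV)"
      by (intro continuous_imp_measurable_on_sets_lebesgue uc) auto
    fix K :: "(real^'n) set" assume K: "compact K \<and> K \<subseteq> UNIV"
    then have "bounded (u ` K)"
      using uc by (meson compact_continuous_image compact_imp_bounded continuous_on_subset)
    then obtain C where "\<And>x. x \<in> K \<Longrightarrow> norm (u x) \<le> C"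
      unfolding bounded_iff by auto
    then show "\<exists>C. AE x in lebesgue_on K. norm (u x) \<le> C"
      by (intro exI[of _ C] AE_I2) auto
  qed
  moreover have "Linf_loc UNIV G"
    unfolding Linf_loc_def lebesgue_on_UNIV_eq
  proof (intro conjI allI impI)
    show "G \<in> borel_measurable lebesgue"
      using G(2) by (simp add: measurable_completion)
    show "\<exists>C. AE x in lebesgue_on K. norm (G x) \<le> C" for K
      using B by (intro exI[of _ B] AE_I2)
  qed
  moreover have "(LINT x|lebesgue_on UNIV. u x * partial_deriv i \<phi> x)
                  = - (LINT x|lebesgue_on UNIV. (G x $ i) * \<phi> x)"
    if t: "test_function UNIV \<phi>" for \<phi> i
  proof -
    obtain K where K: "compact K" "\<And>x. x \<notin> K \<Longrightarrow> \<phi> x = 0"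
      using test_function_support[OF t] by metis
    obtain D where D: "\<And>x. (\<phi> has_derivative D x) (at x)"
        "\<And>x i. D x (axis i 1) = partial_deriv i \<phi> x" "\<And>i. continuous_on UNIV (partial_deriv i \<phi>)"
      using test_function_derivative[OF t] by metis
    have \<phi>c: "continuous_on UNIV \<phi>"
      using D by (meson has_derivative_continuous continuous_at_imp_continuous_on)
    note [measurable] = borel_measurable_continuous_onI[OF \<phi>c] borel_measurable_continuous_onI[OF D(3)]
    have [measurable]: "(\<lambda>x. G x $ i) \<in> borel_measurable borel"
      using borel_measurable_continuous_onI[OF continuous_on_component[OF continuous_on_id]] G(2)
      by (rule measurable_compose_rev)
    have "(LINT x|lborel. u x * D x (axis i 1)) = - (LINT x|lborel. (G x \<bullet> axis i 1) * \<phi> x)"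
      using D by (intro lipschitz_weak_derivative[OF L G D(1) _ K]) simp_all
    then have "(LINT x|lborel. u x * partial_deriv i \<phi> x) = - (LINT x|lborel. (G x $ i) * \<phi> x)"
      by (simp add: D inner_axis)
    then show ?thesis
      unfolding lebesgue_on_UNIV_eq by (simp add: integral_completion)
  qed
  ultimately show ?thesis
    unfolding W1inf_loc_def by blast
qed

text \<open>The definition of the weak gradient tests coordinate directions only; a linear combination with the
  coefficients of \<open>e\<close> gives every direction. Local boundedness of \<open>v\<close> and \<open>Dv\<close> on the support of
  \<open>\<phi>\<close> makes each term integrable.\<close>

lemma W1inf_loc_directional:
  assumes v: "W1inf_loc V v Dv" and V: "open V" and t: "test_function V \<phi>"
    and \<phi>: "\<And>x. (\<phi> has_derivative D x) (at x)"
  shows "(LINT x|lebesgue_on V. v x * D x e) = - (LINT x|lebesgue_on V. (e \<bullet> Dv x) * \<phi> x)"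
    and "integrable (lebesgue_on V) (\<lambda>x. (e \<bullet> Dv x) * \<phi> x)"
proof -
  obtain K where K: "compact K" "K \<subseteq> V" "\<And>x. x \<notin> K \<Longrightarrow> \<phi> x = 0"
    using test_function_support[OF t] by metis
  obtain D' where D: "\<And>x. (\<phi> has_derivative D' x) (at x)"
      "\<And>x i. D' x (axis i 1) = partial_deriv i \<phi> x" 
      "\<And>x e. D' x e = (\<Sum>i\<in>UNIV. e $ i * partial_deriv i \<phi> x)"
      "\<And>i. continuous_on UNIV (partial_deriv i \<phi>)"
    by (rule test_function_derivative[OF t]) (rule that)
  have [simp]: "D' = D"
    by (rule ext) (rule has_derivative_unique[OF D(1) \<phi>])
  have \<phi>c: "continuous_on UNIV \<phi>"
    using \<phi> by (meson has_derivative_continuous continuous_at_imp_continuous_on)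
  have Lv: "Linf_loc V v" and LD: "Linf_loc V Dv"
    using v by (auto simp: W1inf_loc_def)
  have LDi: "Linf_loc V (\<lambda>x. Dv x $ i)" for i
    unfolding Linf_loc_def
  proof (intro conjI allI impI)
    have "Dv \<in> borel_measurable (lebesgue_on V)"
      using LD by (simp add: Linf_loc_def)
    then show "(\<lambda>x. Dv x $ i) \<in> borel_measurable (lebesgue_on V)"
      using borel_measurable_continuous_onI[OF continuous_on_component[OF continuous_on_id]]
      by (rule measurable_compose)
    fix K assume "compact K \<and> K \<subseteq> V"
    then obtain C where "AE x in lebesgue_on K. norm (Dv x) \<le> C"
      using LD unfolding Linf_loc_def by blast
    then have "AE x in lebesgue_on K. norm (Dv x $ i) \<le> C"
      by eventually_elim (simp, rule order_trans[OF component_le_norm_cart])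
    then show "\<exists>C. AE x in lebesgue_on K. norm (Dv x $ i) \<le> C" by blast
  qed
  have off: "partial_deriv i \<phi> x = 0" if "x \<notin> K" for x i
    using derivative_zero_off_support[OF D(1) compact_imp_closed[OF K(1)] K(3) that] D(2) by metis
  have i1: "integrable (lebesgue_on V) (\<lambda>x. v x * partial_deriv i \<phi> x)" for i
    using off by (intro Linf_loc_times_compact_support[OF Lv V D(4) K(1,2)])
  have i2: "integrable (lebesgue_on V) (\<lambda>x. (Dv x $ i) * \<phi> x)" for i
    using K by (intro Linf_loc_times_compact_support[OF LDi V \<phi>c K(1,2)])
  have e: "(e \<bullet> Dv x) * \<phi> x = (\<Sum>i\<in>UNIV. e $ i * ((Dv x $ i) * \<phi> x))" for x
    by (simp add: inner_vec_def sum_distrib_right mult.assoc)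
  show "integrable (lebesgue_on V) (\<lambda>x. (e \<bullet> Dv x) * \<phi> x)"
    unfolding e using i2 by simp
  have "(LINT x|lebesgue_on V. v x * D x e)
      = (LINT x|lebesgue_on V. (\<Sum>i\<in>UNIV. e $ i * (v x * partial_deriv i \<phi> x)))"
    using D(3) by (simp add: sum_distrib_left mult.left_commute)
  also have "\<dots> = (\<Sum>i\<in>UNIV. e $ i * (LINT x|lebesgue_on V. v x * partial_deriv i \<phi> x))"
    using i1 by simp
  also have "\<dots> = - (\<Sum>i\<in>UNIV. e $ i * (LINT x|lebesgue_on V. (Dv x $ i) * \<phi> x))"
    using v t by (simp add: W1inf_loc_def sum_negf)
  also have "\<dots> = - (LINT x|lebesgue_on V. (e \<bullet> Dv x) * \<phi> x)"
    unfolding e using i2 by simp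
  finally show "(LINT x|lebesgue_on V. v x * D x e) = - (LINT x|lebesgue_on V. (e \<bullet> Dv x) * \<phi> x)" .
qed

section \<open>One-sided bounds along segments\<close>

lemma AE_open_witness:
  fixes V :: "'a::euclidean_space set"
  assumes "open V" "V \<noteq> {}" "AE x in lebesgue_on V. P x"
  shows "\<exists>x\<in>V. P x"
proof (rule ccontr)
  assume "\<not> (\<exists>x\<in>V. P x)"
  moreover have "AE x in lebesgue. x \<in> V \<longrightarrow> P x"
    using assms by (simp add: AE_restrict_space_iff)
  ultimately have "AE x in lebesgue. x \<notin> V"
    by (auto elim!: eventually_mono)
  then have "V \<in> null_sets lebesgue"
    using assms(1) by (subst AE_iff_null_sets) auto
  then show False
    using open_not_negligible[OF assms(1,2)] by (simp add: negligible_iff_null_sets)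
qed

lemma integral_bump_pos:
  fixes c :: "real^'n::finite"
  assumes r: "r > 0" and k: "continuous_on UNIV k" "\<And>x. x \<in> ball c r \<Longrightarrow> k x > 0"
    and \<phi>: "continuous_on UNIV (bump r c)"
  shows "(LINT y|lborel. k y * bump r c y) > 0"
proof -
  have off: "bump r c y = 0" if "y \<notin> ball c r" for y
    using bump_pos_iff[OF r, of c y] bump_nonneg[of r c y] that by linarith
  have nn: "0 \<le> k y * bump r c y" for y
    using off[of y] k(2)[of y] bump_nonneg[of r c y] by (cases "y \<in> ball c r") (auto simp del: mem_ball)
  have i: "integrable lborel (\<lambda>y. k y * bump r c y)"
    using off by (intro integrable_compact_support[of _ "cball c r"] continuous_intros k \<phi>) auto
  have "(LINT y|lborel. k y * bump r c y) \<noteq> 0"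
  proof
    assume "(LINT y|lborel. k y * bump r c y) = 0"
    then have "AE y in lborel. k y * bump r c y = 0"
      using integral_nonneg_eq_0_iff_AE[OF i] nn by simp
    then have "AE y in lebesgue. k y * bump r c y = 0"
      by (rule AE_completion)
    then have "AE y in lebesgue_on (ball c r). k y * bump r c y = 0"
      by (simp add: AE_restrict_space_iff eventually_mono)
    then have "\<exists>y\<in>ball c r. k y * bump r c y = 0"
      using r by (intro AE_open_witness) auto
    then show False
      using k(2) bump_pos_iff[OF r, of c] by force
  qed
  moreover have "(LINT y|lborel. k y * bump r c y) \<ge> 0"
    using nn by (intro integral_nonneg_AE) simp
  ultimately show ?thesis by simp
qed

lemma integral_lebesgue_on_eq:
  fixes f g :: "'a::euclidean_space \<Rightarrow> real"
  assumes "V \<in> sets lebesgue" "continuous_on UNIV g"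
    and "\<And>x. x \<in> V \<Longrightarrow> f x = g x" "\<And>x. x \<notin> V \<Longrightarrow> g x = 0"
  shows "(LINT x|lebesgue_on V. f x) = (LINT x|lborel. g x)"
proof -
  have "(LINT x|lebesgue_on V. f x) = (LINT x|lebesgue. indicator V x *\<^sub>R f x)"
    using assms(1) by (simp add: integral_restrict_space)
  also have "(\<lambda>x. indicator V x *\<^sub>R f x) = g"
    using assms(3,4) by (auto simp: indicator_def)
  also have "(LINT x|lebesgue. g x) = (LINT x|lborel. g x)"
    using borel_measurable_continuous_onI[OF assms(2)] by (simp add: integral_completion)
  finally show ?thesis .
qed

text \<open>An almost everywhere bound says nothing on a given segment, which is a null set, so \<open>v\<close> is averaged
  against a bump of small radius that is carried along the segment. The derivative of the average in
  the parameter of the segment is the average of \<open>e \<bullet> Dv\<close>, hence at most \<open>t\<close> times the mass of the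
  bump. If the bound failed at the endpoints, it would fail on small balls around them by continuity,
  and hence for the averages.\<close>

lemma weak_directional_bound:
  fixes v :: "real^'n::finite \<Rightarrow> real"
  assumes v: "W1inf_loc V v Dv" and V: "open V" and cont: "continuous_on V v"
    and bound: "AE x in lebesgue_on V. e \<bullet> Dv x \<le> t"
    and s: "0 \<le> s" and seg: "\<And>\<tau>. 0 \<le> \<tau> \<Longrightarrow> \<tau> \<le> s \<Longrightarrow> x + \<tau> *\<^sub>R e \<in> V"
  shows "v (x + s *\<^sub>R e) - v x \<le> t * s"
proof (rule ccontr)
  assume "\<not> ?thesis"
  then have viol: "t * s < v (x + s *\<^sub>R e) - v x" by simp
  define S where "S = (\<lambda>\<tau>. x + \<tau> *\<^sub>R e) ` {0..s}"
  have S: "compact S" "S \<subseteq> V"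
    using seg by (auto simp: S_def intro!: compact_continuous_image continuous_intros)
  obtain \<epsilon> where \<epsilon>: "\<epsilon> > 0" "(\<Union>c\<in>S. cball c \<epsilon>) \<subseteq> V"
    using compact_subset_open_imp_cball_epsilon_subset[OF S(1) V S(2)] by metis
  define N where "N = (\<Union>c\<in>S. cball c \<epsilon>)"
  have N: "closed N" "N \<subseteq> V"
    using compact_minkowski_sum_cball[OF S(1), of \<epsilon>] \<epsilon>(2) by (auto simp: N_def compact_imp_closed)
  \<comment> \<open>\<open>v\<close> may be discontinuous outside \<open>V\<close>; all bumps used below are supported in \<open>N\<close>, so
    a global continuous extension from \<open>N\<close> has the same averages.\<close>
  obtain w where w: "continuous_on UNIV w" "\<And>y. y \<in> N \<Longrightarrow> w y = v y"
    using Tietze_unbounded[of N v UNIV] continuous_on_subset[OF cont N(2)] N(1) by auto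
  define k where "k y = w (y + s *\<^sub>R e) - w y - t * s" for y
  have kc: "continuous_on UNIV k"
    unfolding k_def by (intro continuous_intros continuous_on_compose2[OF w(1)] w(1)) auto
  have inS: "x + \<tau> *\<^sub>R e \<in> S" if "0 \<le> \<tau>" "\<tau> \<le> s" for \<tau>
    using that by (auto simp: S_def)
  have "x \<in> N" "x + s *\<^sub>R e \<in> N"
    using inS[of 0] inS[of s] s \<epsilon>(1) by (force simp: N_def)+
  then have "k x > 0"
    using viol w(2) by (simp add: k_def)
  moreover have "open {y. k y > 0}"
    by (intro open_Collect_less kc continuous_intros)
  ultimately obtain \<delta> where \<delta>: "\<delta> > 0" "\<And>y. y \<in> ball x \<delta> \<Longrightarrow> k y > 0"
    unfolding open_contains_ball by blast
  define r where "r = min \<delta> \<epsilon>"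
  have r: "r > 0" "r \<le> \<delta>" "r \<le> \<epsilon>"
    using \<delta> \<epsilon> by (auto simp: r_def)
  define \<phi> where "\<phi> = bump r x"
  have "test_function UNIV \<phi>"
    unfolding \<phi>_def by (intro test_function_bump r) simp
  then obtain D where D: "\<And>y. (\<phi> has_derivative D y) (at y)"
      "\<And>y e. D y e = (\<Sum>i\<in>UNIV. e $ i * partial_deriv i \<phi> y)"
      "\<And>i. continuous_on UNIV (partial_deriv i \<phi>)"
    by (rule test_function_derivative) (rule that)
  have Dc: "continuous_on UNIV (\<lambda>y. D y e)"
    unfolding D(2) by (intro continuous_intros D(3))
  have \<phi>c: "continuous_on UNIV \<phi>"
    using D(1) by (meson has_derivative_continuous continuous_at_imp_continuous_on)
  have off: "\<phi> y = 0" if "y \<notin> cball x r" for y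
    using bump_pos_iff[OF r(1), of x y] bump_nonneg[of r x y] that by (force simp: \<phi>_def)
  have Doff: "D y e = 0" if "y \<notin> cball x r" for y
    by (rule derivative_zero_off_support[OF D(1) _ off that]) auto
  define M where "M = (LINT y|lborel. \<phi> y)"
  define g where "g \<tau> = (LINT y|lborel. w y * \<phi> (y - \<tau> *\<^sub>R e))" for \<tau>
  have dg: "(g has_real_derivative - (LINT y|lborel. w y * D (y - \<tau> *\<^sub>R e) e)) (at \<tau>)" for \<tau>
    unfolding g_def[abs_def] by (rule translation_derivative[OF w(1) D(1) Dc compact_cball off])
  have slope: "- (LINT y|lborel. w y * D (y - \<tau> *\<^sub>R e) e) \<le> t * M" if \<tau>: "0 \<le> \<tau>" "\<tau> \<le> s" for \<tau>
  proof -
    define \<psi> where "\<psi> = (\<lambda>y. \<phi> (y - \<tau> *\<^sub>R e))"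
    have sub: "cball (x + \<tau> *\<^sub>R e) r \<subseteq> N"
      using inS[OF \<tau>] r(3) by (force simp: N_def)
    have mem: "y - \<tau> *\<^sub>R e \<in> cball x r \<longleftrightarrow> y \<in> cball (x + \<tau> *\<^sub>R e) r" for y
      by (simp add: dist_norm algebra_simps)
    have "\<psi> = bump r (x + \<tau> *\<^sub>R e)"
      by (simp add: \<psi>_def \<phi>_def fun_eq_iff bump_translate)
    then have t\<psi>: "test_function V \<psi>"
      using test_function_bump[OF r(1) order_trans[OF sub N(2)]] by simp
    have \<psi>D: "(\<psi> has_derivative D (y - \<tau> *\<^sub>R e)) (at y)" for y
      unfolding \<psi>_def
      by (rule has_derivative_compose[of "\<lambda>y. y - \<tau> *\<^sub>R e" "\<lambda>h. h", OF _ D(1)])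
         (auto intro!: derivative_eq_intros)
    have \<psi>c: "continuous_on UNIV \<psi>"
      unfolding \<psi>_def by (intro continuous_on_compose2[OF \<phi>c] continuous_intros) auto
    have Vs: "V \<in> sets lebesgue" using V by simp
    have \<psi>off: "\<psi> y = 0" if "y \<notin> V" for y
      using off[of "y - \<tau> *\<^sub>R e"] mem[of y] sub N(2) that by (auto simp: \<psi>_def)
    have "(LINT y|lborel. w y * D (y - \<tau> *\<^sub>R e) e) = (LINT y|lebesgue_on V. v y * D (y - \<tau> *\<^sub>R e) e)"
    proof (rule integral_lebesgue_on_eq[symmetric, OF Vs])
      show "continuous_on UNIV (\<lambda>y. w y * D (y - \<tau> *\<^sub>R e) e)"
        by (intro continuous_intros w continuous_on_compose2[OF Dc]) auto
      show "v y * D (y - \<tau> *\<^sub>R e) e = w y * D (y - \<tau> *\<^sub>R e) e" for y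
        using w(2)[of y] Doff[of "y - \<tau> *\<^sub>R e"] mem[of y] sub by auto
      show "w y * D (y - \<tau> *\<^sub>R e) e = 0" if "y \<notin> V" for y
        using that Doff[of "y - \<tau> *\<^sub>R e"] mem[of y] sub N(2) by auto
    qed
    also have "- \<dots> = (LINT y|lebesgue_on V. (e \<bullet> Dv y) * \<psi> y)"
      using W1inf_loc_directional(1)[OF v V t\<psi> \<psi>D] by simp
    also have "\<dots> \<le> (LINT y|lebesgue_on V. t * \<psi> y)"
    proof (rule integral_mono_AE)
      show "integrable (lebesgue_on V) (\<lambda>y. (e \<bullet> Dv y) * \<psi> y)"
        by (rule W1inf_loc_directional(2)[OF v V t\<psi> \<psi>D])
      have "integrable lebesgue \<psi>"
        using integrable_compact_support[OF \<psi>c compact_cball, of "x + \<tau> *\<^sub>R e" r] off mem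
          borel_measurable_continuous_onI[OF \<psi>c] by (simp add: integrable_completion \<psi>_def)
      then show "integrable (lebesgue_on V) (\<lambda>y. t * \<psi> y)"
        using Vs integrable_restrict_space[of V lebesgue \<psi>] integrable_mult_indicator[of V lebesgue \<psi>]
        by simp
      show "AE y in lebesgue_on V. (e \<bullet> Dv y) * \<psi> y \<le> t * \<psi> y"
        using bound by eventually_elim (auto simp: \<psi>_def \<phi>_def bump_nonneg intro: mult_right_mono)
    qed
    also have "\<dots> = (LINT y|lborel. t * \<psi> y)"
      using \<psi>off by (intro integral_lebesgue_on_eq Vs continuous_intros \<psi>c) auto
    also have "(LINT y|lborel. \<psi> y) = M"
      using integral_translation[OF borel_measurable_continuous_onI[OF \<phi>c], of "- (\<tau> *\<^sub>R e)"]
      by (simp add: M_def \<psi>_def)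
    then have "(LINT y|lborel. t * \<psi> y) = t * M" by simp
    finally show ?thesis .
  qed
  \<comment> \<open>\<open>g\<close> grows at rate at most \<open>t * M\<close>, which contradicts the positivity of \<open>k\<close> on the support
    of the bump.\<close>
  have "g s - t * M * s \<le> g 0 - t * M * 0"
  proof (rule DERIV_nonpos_imp_nonincreasing[OF s])
    fix \<tau> assume "0 \<le> \<tau>" "\<tau> \<le> s"
    moreover have "((\<lambda>\<tau>. g \<tau> - t * M * \<tau>) has_real_derivative
         - (LINT y|lborel. w y * D (y - \<tau> *\<^sub>R e) e) - t * M) (at \<tau>)"
      by (auto intro!: derivative_eq_intros dg)
    ultimately show "\<exists>y. ((\<lambda>\<tau>. g \<tau> - t * M * \<tau>) has_real_derivative y) (at \<tau>) \<and> y \<le> 0"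
      using slope[of \<tau>] by (intro exI conjI) auto
  qed
  moreover have "g s - t * M * s - g 0 = (LINT y|lborel. k y * \<phi> y)"
  proof -
    have i: "integrable lborel (\<lambda>y. h y * \<phi> y)" if "continuous_on UNIV h" for h
      using off by (intro integrable_compact_support[of _ "cball x r"] continuous_intros that \<phi>c) auto
    have wc: "continuous_on UNIV (\<lambda>y. w (y + s *\<^sub>R e))"
      by (intro continuous_on_compose2[OF w(1)] continuous_intros) auto
    have "(\<lambda>y. w y * \<phi> (y - s *\<^sub>R e)) \<in> borel_measurable borel"
      by (intro borel_measurable_continuous_onI continuous_intros w continuous_on_compose2[OF \<phi>c]) auto
    from integral_translation[OF this, of "s *\<^sub>R e"]
    have "g s = (LINT y|lborel. w (y + s *\<^sub>R e) * \<phi> y)"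
      by (simp add: g_def)
    moreover have "(LINT y|lborel. k y * \<phi> y)
        = (LINT y|lborel. w (y + s *\<^sub>R e) * \<phi> y - w y * \<phi> y - t * s * \<phi> y)"
      by (simp add: k_def algebra_simps)
    moreover have "\<dots> = (LINT y|lborel. w (y + s *\<^sub>R e) * \<phi> y) - (LINT y|lborel. w y * \<phi> y) - t * s * M"
      using i[OF wc] i[OF w(1)] i[OF continuous_on_const, of "t * s"]
      by (simp add: M_def)
    ultimately show ?thesis
      by (simp add: g_def)
  qed
  moreover have "(LINT y|lborel. k y * \<phi> y) > 0"
    using \<delta>(2) r \<phi>c unfolding \<phi>_def by (intro integral_bump_pos kc) auto
  ultimately show False by simp
qed

text \<open>The line in direction \<open>e\<close> through a point of \<open>V\<close> is followed both ways until it leaves \<open>V\<close>. The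
  resulting open chord lies in \<open>V\<close>, where the bound on segments applies, and continuity on the closure
  extends it to the end points. These lie on the boundary, where a competitor agrees with the
  minimizer.\<close>

lemma weak_directional_bound_chord:
  fixes v :: "real^'n::finite \<Rightarrow> real"
  assumes v: "W1inf_loc V v Dv" and V: "open V" "bounded V" "V \<noteq> {}"
    and cont: "continuous_on (closure V) v"
    and bound: "AE x in lebesgue_on V. e \<bullet> Dv x \<le> t" and e: "e \<noteq> 0"
  obtains y s where "s > 0" "y \<in> frontier V" "y + s *\<^sub>R e \<in> frontier V" "v (y + s *\<^sub>R e) - v y \<le> t * s"
proof -
  obtain x where x: "x \<in> V" using V by blast
  obtain d1 where d1: "d1 > 0" "x + d1 *\<^sub>R e \<in> frontier V"
      "\<And>\<tau>. 0 \<le> \<tau> \<Longrightarrow> \<tau> < d1 \<Longrightarrow> x + \<tau> *\<^sub>R e \<in> V"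
    using ray_to_frontier[OF V(2), of x e] x V(1) e by (metis interior_open)
  obtain d2 where d2: "d2 > 0" "x + d2 *\<^sub>R (- e) \<in> frontier V"
      "\<And>\<tau>. 0 \<le> \<tau> \<Longrightarrow> \<tau> < d2 \<Longrightarrow> x + \<tau> *\<^sub>R (- e) \<in> V"
    using ray_to_frontier[OF V(2), of x "- e"] x V(1) e by (metis interior_open neg_equal_0_iff_equal)
  have inV: "x + \<tau> *\<^sub>R e \<in> V" if "\<tau> \<in> {-d2<..<d1}" for \<tau>
    using that d1(3)[of \<tau>] d2(3)[of "-\<tau>"] by (cases "\<tau> \<ge> 0") auto
  have cl: "x + \<tau> *\<^sub>R e \<in> closure V" if \<tau>: "\<tau> \<in> {-d2..d1}" for \<tau>
  proof -
    consider "\<tau> = d1" | "\<tau> = - d2" | "\<tau> \<in> {-d2<..<d1}"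
      using \<tau> by fastforce
    then show ?thesis
      using d1(2) d2(2) inV closure_subset by cases (auto simp: frontier_def)
  qed
  define h where "h \<tau> = v (x + \<tau> *\<^sub>R e) - t * \<tau>" for \<tau>
  have hc: "continuous_on {-d2..d1} h"
    unfolding h_def using cl by (intro continuous_intros continuous_on_compose2[OF cont]) auto
  have mono: "h \<tau> \<le> h \<sigma>" if "\<sigma> \<in> {-d2<..<d1}" "\<tau> \<in> {-d2<..<d1}" "\<sigma> \<le> \<tau>" for \<sigma> \<tau>
  proof -
    have "v ((x + \<sigma> *\<^sub>R e) + (\<tau> - \<sigma>) *\<^sub>R e) - v (x + \<sigma> *\<^sub>R e) \<le> t * (\<tau> - \<sigma>)"
    proof (rule weak_directional_bound[OF v V(1) continuous_on_subset[OF cont closure_subset] bound])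
      fix \<rho> assume "0 \<le> \<rho>" "\<rho> \<le> \<tau> - \<sigma>"
      then show "x + \<sigma> *\<^sub>R e + \<rho> *\<^sub>R e \<in> V"
        using inV[of "\<sigma> + \<rho>"] that by (simp add: scaleR_add_left add.assoc)
    qed (use that in simp)
    then show ?thesis
      by (simp add: h_def algebra_simps)
  qed
  have right: "h d1 \<le> h \<sigma>" if \<sigma>: "\<sigma> \<in> {-d2<..<d1}" for \<sigma>
  proof (rule continuous_le_on_closure[of "{\<sigma><..<d1}" h])
    show "continuous_on (closure {\<sigma><..<d1}) h"
      using \<sigma> by (intro continuous_on_subset[OF hc]) auto
  qed (use \<sigma> mono in auto)
  have "h d1 \<le> h (- d2)"
  proof (rule continuous_ge_on_closure[of "{-d2<..<d1}" h])
    show "continuous_on (closure {-d2<..<d1}) h"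
      using d1 d2 by (intro continuous_on_subset[OF hc]) auto
  qed (use right d1 d2 in auto)
  then have le: "v (x + d1 *\<^sub>R e) - v (x - d2 *\<^sub>R e) \<le> t * (d1 + d2)"
    by (simp add: h_def algebra_simps)
  have eq: "(x - d2 *\<^sub>R e) + (d1 + d2) *\<^sub>R e = x + d1 *\<^sub>R e"
    by (simp add: algebra_simps)
  show ?thesis
    by (rule that[of "d1 + d2" "x - d2 *\<^sub>R e"], unfold eq) (use d1 d2 le in auto)
qed

section \<open>The fold function\<close>

text \<open>Both values lie in \<open>[a,b]\<close>, also on the fold \<open>(b - a) \<bullet> x = 0\<close>, so that \<open>H\<close> is constant along this
  gradient everywhere.\<close>

definition grad_u_f :: "real^'n::finite \<Rightarrow> real^'n \<Rightarrow> real^'n \<Rightarrow> real^'n" where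
  "grad_u_f a b x = (if (b - a) \<bullet> x \<ge> 0 then b else a)"

lemma u_f_eq: "u_f a b x = (if (b - a) \<bullet> x \<ge> 0 then b \<bullet> x else a \<bullet> x)"
  by (auto simp: u_f_def inner_diff_left inner_add_left field_simps)

lemma u_f_eq_max: "u_f a b x = max (a \<bullet> x) (b \<bullet> x)"
  by (auto simp: u_f_eq inner_diff_left)

lemma u_f_reflect: "u_f a b x + u_f a b (- x) = \<bar>(b - a) \<bullet> x\<bar>"
  by (auto simp: u_f_eq inner_diff_left)

lemma u_f_0: "u_f a b 0 = 0"
  by (simp add: u_f_def)

lemma u_f_scale: "s \<ge> 0 \<Longrightarrow> u_f a b (s *\<^sub>R x) = s * u_f a b x"
  by (simp add: u_f_def abs_mult distrib_left)

text \<open>A function that is affine, or is approximated at the origin by linear functions, would have an odd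
  first-order part there; since \<open>u_f\<close> is positively homogeneous, its failure to be odd near \<open>0\<close> excludes
  every form of linearity at once.\<close>

lemma u_f_not_odd:
  assumes "a \<noteq> b" "r > 0"
  obtains y where "y \<in> ball 0 r" "- y \<in> ball 0 r" "u_f a b (- y) \<noteq> - u_f a b y"
proof
  define y where "y = (r / (2 * norm (b - a))) *\<^sub>R (b - a)"
  have "norm y = r / 2"
    using assms by (simp add: y_def)
  then show "y \<in> ball 0 r" "- y \<in> ball 0 r"
    using assms by auto
  have "(b - a) \<bullet> y \<noteq> 0"
    using assms by (simp add: y_def)
  then show "u_f a b (- y) \<noteq> - u_f a b y"
    using u_f_reflect[of a b y] by auto
qed

lemma u_f_lipschitz: "(norm ((b + a) /\<^sub>R 2) + norm ((b - a) /\<^sub>R 2))-lipschitz_on UNIV (u_f a b)"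
proof (rule lipschitz_onI)
  fix x y
  let ?m = "(b + a) /\<^sub>R 2" and ?d = "(b - a) /\<^sub>R 2"
  have "\<bar>u_f a b x - u_f a b y\<bar> \<le> \<bar>?m \<bullet> (x - y)\<bar> + \<bar>?d \<bullet> (x - y)\<bar>"
    unfolding u_f_def inner_diff_right by linarith
  also have "\<dots> \<le> norm ?m * norm (x - y) + norm ?d * norm (x - y)"
    by (intro add_mono Cauchy_Schwarz_ineq2)
  finally show "dist (u_f a b x) (u_f a b y) \<le> (norm ?m + norm ?d) * dist x y"
    by (simp add: dist_norm distrib_right)
qed simp

lemma u_f_has_derivative:
  assumes "(b - a) \<bullet> x \<noteq> 0"
  shows "(u_f a b has_derivative (\<lambda>h. grad_u_f a b x \<bullet> h)) (at x)"
proof (cases "(b - a) \<bullet> x > 0")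
  case True
  have "((\<lambda>x. b \<bullet> x) has_derivative (\<lambda>h. grad_u_f a b x \<bullet> h)) (at x)"
    using True by (auto intro!: derivative_eq_intros simp: grad_u_f_def)
  moreover have "open {x. (b - a) \<bullet> x > 0}"
    by (intro open_Collect_less continuous_intros)
  ultimately show ?thesis
    by (rule has_derivative_transform_within_open) (use True in \<open>auto simp: u_f_eq\<close>)
next
  case False
  then have neg: "(b - a) \<bullet> x < 0" using assms by simp
  have "((\<lambda>x. a \<bullet> x) has_derivative (\<lambda>h. grad_u_f a b x \<bullet> h)) (at x)"
    using neg by (auto intro!: derivative_eq_intros simp: grad_u_f_def)
  moreover have "open {x. (b - a) \<bullet> x < 0}"
    by (intro open_Collect_less continuous_intros)
  ultimately show ?thesis
    by (rule has_derivative_transform_within_open) (use neg in \<open>auto simp: u_f_eq\<close>)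
qed

lemma W1inf_loc_u_f:
  assumes "a \<noteq> b"
  shows "W1inf_loc UNIV (u_f a b) (grad_u_f a b)"
proof (rule W1inf_loc_lipschitz[OF u_f_lipschitz])
  have "{x. (b - a) \<bullet> x = 0} \<in> null_sets lebesgue"
    using negligible_hyperplane[of "b - a" 0] assms by (simp add: negligible_iff_null_sets)
  then have "AE x in lebesgue. x \<notin> {x. (b - a) \<bullet> x = 0}"
    by (rule AE_not_in)
  then have "AE x in lborel. (b - a) \<bullet> x \<noteq> 0"
    by (simp add: AE_completion_iff)
  then show "AE x in lborel. (u_f a b has_derivative (\<lambda>h. grad_u_f a b x \<bullet> h)) (at x)"
    by eventually_elim (rule u_f_has_derivative)
  show "grad_u_f a b \<in> borel_measurable borel"
    unfolding grad_u_f_def[abs_def] by measurable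
  show "norm (grad_u_f a b x) \<le> max (norm a) (norm b)" for x
    by (simp add: grad_u_f_def)
qed

lemma u_f_increase:
  assumes "t < e \<bullet> a" "t < e \<bullet> b" "s > 0"
  shows "t * s < u_f a b (y + s *\<^sub>R e) - u_f a b y"
proof -
  have "t * s < s * (a \<bullet> e)" "t * s < s * (b \<bullet> e)"
    using assms by (simp_all add: inner_commute mult.commute)
  then show ?thesis
    by (auto simp: u_f_eq_max inner_add_right max_def)
qed

lemma not_Ck1_u_f:
  fixes a b :: "real^'n::finite"
  assumes "a \<noteq> b"
  shows "\<not> Ck 1 (u_f a b)"
proof
  assume "Ck 1 (u_f a b)"
  then have "u_f a b differentiable (at 0)"
    by simp
  then obtain D where D: "(u_f a b has_derivative D) (at 0)"
    unfolding differentiable_def by blast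
  have eq: "u_f a b y = D y" for y
  proof -
    have "((\<lambda>s. s *\<^sub>R y) has_derivative (\<lambda>s. s *\<^sub>R y)) (at 0)"
      by (auto intro!: derivative_eq_intros)
    then have "((\<lambda>s. u_f a b (s *\<^sub>R y)) has_derivative (\<lambda>s. D (s *\<^sub>R y))) (at 0)"
      by (rule has_derivative_compose) (simp add: D)
    moreover have "linear D" using D has_derivative_linear by blast
    ultimately have "((\<lambda>s. u_f a b (s *\<^sub>R y)) has_real_derivative D y) (at 0)"
      by (simp add: has_field_derivative_def linear_scale mult_commute_abs)
    then have "((\<lambda>s. u_f a b (s *\<^sub>R y) / s) \<longlongrightarrow> D y) (at_right 0)"
      by (auto simp: has_field_derivative_iff u_f_0 intro: filterlim_mono at_le)
    moreover have "\<forall>\<^sub>F s in at_right 0. u_f a b (s *\<^sub>R y) / s = u_f a b y"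
      by (auto simp: u_f_scale eventually_at_filter)
    ultimately have "((\<lambda>s. u_f a b y) \<longlongrightarrow> D y) (at_right (0::real))"
      by (rule Lim_transform_eventually)
    then show ?thesis
      by (simp add: tendsto_const_iff)
  qed
  obtain y where "u_f a b (- y) \<noteq> - u_f a b y"
    using u_f_not_odd[OF assms zero_less_one] by blast
  moreover have "D (- y) = - D y"
    using D has_derivative_linear linear_neg by blast
  ultimately show False
    by (simp add: eq)
qed

text \<open>By homogeneity the rescalings of \<open>u_f\<close> at the origin do not depend on the scale, so a blow-up limit
  that is linear forces \<open>u_f\<close> itself to be linear on the unit ball.\<close>

lemma not_linear_approximation_property_u_f:
  fixes a b :: "real^'n::finite"
  assumes "a \<noteq> b"
  shows "\<not> linear_approximation_property (u_f a b)"
proof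
  define r where "r i = inverse (real (Suc i))" for i
  have r: "\<forall>i. r i > 0" "r \<longlonglongrightarrow> 0"
    using LIMSEQ_inverse_real_of_nat by (auto simp: r_def[abs_def])
  assume "linear_approximation_property (u_f a b)"
  then obtain s e where lim: "(\<lambda>k. SUP y\<in>ball 0 1. ereal
      \<bar>(u_f a b (0 + r (s k) *\<^sub>R y) - u_f a b 0) / r (s k) - e \<bullet> y\<bar>) \<longlonglongrightarrow> 0"
    unfolding linear_approximation_property_def using r by meson
  have "(u_f a b (0 + r i *\<^sub>R y) - u_f a b 0) / r i = u_f a b y" for i y
    using r(1) by (simp add: u_f_0 u_f_scale less_imp_le less_imp_neq[symmetric])
  with lim have "(\<lambda>k::nat. SUP y\<in>ball 0 1. ereal \<bar>u_f a b y - e \<bullet> y\<bar>) \<longlonglongrightarrow> 0"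
    by simp
  then have sup: "(SUP y\<in>ball 0 1. ereal \<bar>u_f a b y - e \<bullet> y\<bar>) = 0"
    by (simp add: LIMSEQ_const_iff)
  have eq: "u_f a b y = e \<bullet> y" if "y \<in> ball 0 1" for y
    using SUP_upper[OF that, of "\<lambda>y. ereal \<bar>u_f a b y - e \<bullet> y\<bar>"] unfolding sup by simp
  obtain y where "y \<in> ball 0 1" "- y \<in> ball 0 1" "u_f a b (- y) \<noteq> - u_f a b y"
    using u_f_not_odd[OF assms zero_less_one] by blast
  then show False
    using eq[of y] eq[of "- y"] by simp
qed

lemma not_linear_function_u_f:
  fixes a b :: "real^'n::finite"
  assumes "a \<noteq> b"
  shows "\<not> linear_function (u_f a b)"
proof
  assume "linear_function (u_f a b)"
  then obtain c p where cp: "\<And>x. u_f a b x = c + p \<bullet> x"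
    by (auto simp: linear_function_def)
  obtain y where "u_f a b (- y) \<noteq> - u_f a b y"
    using u_f_not_odd[OF assms zero_less_one] by blast
  then show False
    using cp[of 0] cp[of y] cp[of "- y"] by (simp add: u_f_0)
qed

lemma linear_growth_u_f:
  fixes a b :: "real^'n::finite"
  shows "linear_growth (u_f a b)"
proof -
  let ?L = "norm ((b + a) /\<^sub>R 2) + norm ((b - a) /\<^sub>R 2)"
  have "\<bar>u_f a b x\<bar> \<le> (?L + 1) * (1 + norm x)" for x
  proof -
    have "\<bar>u_f a b x\<bar> \<le> ?L * norm x"
      using lipschitz_onD[OF u_f_lipschitz, of x 0 a b] by (simp add: dist_norm u_f_0)
    also have "\<dots> \<le> (?L + 1) * (1 + norm x)"
      by (intro mult_mono) auto
    finally show ?thesis .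
  qed
  then show ?thesis
    unfolding linear_growth_def
    by (intro exI[of _ "?L + 1"]) (auto simp: add_nonneg_pos)
qed

text \<open>A competitor with \<open>H(Dv) \<le> l < H(a)\<close> almost everywhere has its gradient in the convex closed set
  \<open>{H \<le> l}\<close>, which a hyperplane with normal \<open>e\<close> separates strictly from \<open>[a,b]\<close>. Then \<open>u_f\<close> grows
  strictly faster than \<open>v\<close> in direction \<open>e\<close>, which is impossible on a chord of \<open>V\<close> whose end points
  both lie on the boundary.\<close>

lemma absolute_minimizer_u_f:
  fixes H :: "real^'n::finite \<Rightarrow> real"
  assumes Hc: "continuous_on UNIV H" and Hconv: "convex_on UNIV H" and ab: "a \<noteq> b"
    and const: "H constant_on closed_segment a b"
  shows "absolute_minimizer H (u_f a b)"
  unfolding absolute_minimizer_def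
proof (intro conjI exI[of _ "grad_u_f a b"] allI impI)
  show "continuous_on UNIV (u_f a b)"
    using u_f_lipschitz lipschitz_on_continuous_on by blast
  show "W1inf_loc UNIV (u_f a b) (grad_u_f a b)"
    by (rule W1inf_loc_u_f[OF ab])
  obtain c where c: "\<And>p. p \<in> closed_segment a b \<Longrightarrow> H p = c"
    using const by (auto simp: constant_on_def)
  have Hgrad: "H (grad_u_f a b x) = c" for x
    by (simp add: grad_u_f_def c)
  fix V v Dv
  assume "open V \<and> bounded V \<and> W1inf_loc V v Dv \<and> continuous_on (closure V) v \<and>
            (\<forall>x\<in>frontier V. v x = u_f a b x)"
  then have V: "open V" "bounded V" and v: "W1inf_loc V v Dv" "continuous_on (closure V) v"
    and bd: "\<And>x. x \<in> frontier V \<Longrightarrow> v x = u_f a b x"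
    by auto
  show "esssup (lebesgue_on V) (\<lambda>x. ereal (H (grad_u_f a b x))) \<le> esssup (lebesgue_on V) (\<lambda>x. ereal (H (Dv x)))"
  proof (cases "V = {}")
    case True
    then show ?thesis
      by (subst esssup_zero_space) (simp_all add: Hgrad)
  next
    case False
    have "esssup (lebesgue_on V) (\<lambda>x. ereal (H (grad_u_f a b x))) \<le> ereal c"
      by (rule esssup_I) (simp_all add: Hgrad)
    moreover have "ereal c \<le> esssup (lebesgue_on V) (\<lambda>x. ereal (H (Dv x)))"
    proof (rule ccontr)
      assume "\<not> ?thesis"
      then obtain l where l: "esssup (lebesgue_on V) (\<lambda>x. ereal (H (Dv x))) < ereal l" "l < c"
        using ereal_dense2 by (metis less_ereal.simps(1) not_le)
      define S where "S = {p. H p \<le> l}"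
      have AE: "AE x in lebesgue_on V. Dv x \<in> S"
        using esssup_AE[where M="lebesgue_on V" and f="\<lambda>x. ereal (H (Dv x))"]
      proof eventually_elim
        case (elim x)
        then have "ereal (H (Dv x)) < ereal l" using l(1) by (rule le_less_trans)
        then show ?case by (simp add: S_def)
      qed
      have "convex S"
      proof (rule convexI)
        fix p q and s t :: real
        assume "p \<in> S" "q \<in> S" and st: "0 \<le> s" "0 \<le> t" "s + t = 1"
        then have "s * H p + t * H q \<le> l"
          unfolding S_def by (intro convex_bound_le) auto
        moreover have "H (s *\<^sub>R p + t *\<^sub>R q) \<le> s * H p + t * H q"
          using Hconv st unfolding convex_on_def by blast
        ultimately show "s *\<^sub>R p + t *\<^sub>R q \<in> S"
          by (simp add: S_def)
      qed
      moreover have "closed S"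
        unfolding S_def by (intro closed_Collect_le Hc continuous_on_const)
      moreover have "S \<inter> closed_segment a b = {}"
        using c l(2) by (auto simp: S_def)
      ultimately have "\<exists>e t. (\<forall>p\<in>S. e \<bullet> p < t) \<and> (\<forall>p\<in>closed_segment a b. e \<bullet> p > t)"
        by (intro separating_hyperplane_closed_compact) auto
      then obtain e t where e: "\<And>p. p \<in> S \<Longrightarrow> e \<bullet> p < t" "\<And>p. p \<in> closed_segment a b \<Longrightarrow> e \<bullet> p > t"
        by blast
      have "\<exists>x\<in>V. Dv x \<in> S"
        by (rule AE_open_witness[OF V(1) False AE])
      then obtain p where "p \<in> S" by blast
      \<comment> \<open>A strict separation of two nonempty sets has a nonzero normal.\<close>
      with e(1)[of p] e(2)[of a] have e0: "e \<noteq> 0"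
        by auto
      have "AE x in lebesgue_on V. e \<bullet> Dv x \<le> t"
        using AE by eventually_elim (use e(1) less_imp_le in blast)
      then obtain y s where y: "s > 0" "y \<in> frontier V" "y + s *\<^sub>R e \<in> frontier V"
          "v (y + s *\<^sub>R e) - v y \<le> t * s"
        using weak_directional_bound_chord[OF v(1) V False v(2) _ e0] by metis
      have "t * s < u_f a b (y + s *\<^sub>R e) - u_f a b y"
        using e(2) y(1) by (intro u_f_increase) auto
      then show False
        using y bd by simp
    qed
    ultimately show ?thesis
      by (rule order_trans)
  qed
qed

theorem lemma4p2:
  fixes H :: "real^'n::finite \<Rightarrow> real" and a b :: "real^'n"
  assumes "CARD('n) \<ge> 2"
    and "continuous_on UNIV H"
    and "convex_on UNIV H"
    and "superlinear H"
    and "H 0 = 0" and "\<forall>p. H 0 \<le> H p"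
    and "a \<noteq> b"
    and "H constant_on closed_segment a b"
  shows "\<not> Ck 1 (u_f a b) \<and>
    \<not> linear_approximation_property (u_f a b) \<and>
    absolute_minimizer H (u_f a b) \<and>
    linear_growth (u_f a b) \<and>
    \<not> linear_function (u_f a b)"
  by (intro conjI not_Ck1_u_f not_linear_approximation_property_u_f absolute_minimizer_u_f
      linear_growth_u_f not_linear_function_u_f assms)

end
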